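(* Let $\Lambda\subset[0,\infty)$ be an unbounded, infinite discrete set. Suppose that $\Lambda$ is type $2$, that is, there exists a measurable function $f:\mathbb{R}\to[0,+\infty)$ such that both $D(f,\Lambda)$ and $C(f,\Lambda)$ have positive Lebesgue measure. Then there exists a function $g:\mathbb{R}\to\{0,1\}$ which is the characteristic function of an open subset of $\mathbb{R}$ and such that both $D(g,\Lambda)$ and $C(g,\Lambda)$ have positive Lebesgue measure.
   Context: Here "discrete" means that $\Lambda$ has only finitely many elements in each bounded interval, so the elements of $\Lambda$ can be listed as $\lambda_1<\lambda_2<\dots$ with $\lambda_n\to\infty$. For a measurable function $f:\mathbb{R}\to[0,+\infty)$ put $s_f(x)=\sum_{\lambda\in\Lambda}f(x+\lambda)$ for $x\in\mathbb{R}$, and define $C(f,\Lambda)=\{x\in\mathbb{R}: s_f(x)<\infty\}$ and $D(f,\Lambda)=\{x\in\mathbb{R}: s_f(x)=\infty\}$. *)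

theory Defs
  imports "HOL-Analysis.Analysis"
begin

definition discrete_reals :: "real set \<Rightarrow> bool" where
  "discrete_reals \<Lambda> \<longleftrightarrow> (\<forall>a b. finite (\<Lambda> \<inter> {a..b}))"

text \<open>The sum is taken in \<^typ>\<open>ennreal\<close>, where every family is summable; it takes
  the value \<open>\<infinity>\<close> exactly when the series diverges. Since \<^const>\<open>ennreal\<close> truncates
  negative reals to 0, this is meaningful only for nonnegative \<open>f\<close>.\<close>

definition translate_sum :: "(real \<Rightarrow> real) \<Rightarrow> real set \<Rightarrow> real \<Rightarrow> ennreal" where
  "translate_sum f \<Lambda> x = (\<Sum>\<^sub>\<infinity>l\<in>\<Lambda>. ennreal (f (x + l)))"

definition conv_set :: "(real \<Rightarrow> real) \<Rightarrow> real set \<Rightarrow> real set" where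
  "conv_set f \<Lambda> = {x. translate_sum f \<Lambda> x < \<infinity>}"

definition div_set :: "(real \<Rightarrow> real) \<Rightarrow> real set \<Rightarrow> real set" where
  "div_set f \<Lambda> = {x. translate_sum f \<Lambda> x = \<infinity>}"

text \<open>Measurability of \<open>f\<close> is Lebesgue measurability. For such \<open>f\<close> and countable \<open>\<Lambda>\<close>
  both sets below are Lebesgue measurable, so \<^const>\<open>emeasure\<close> is their true measure.\<close>

definition type2 :: "real set \<Rightarrow> bool" where
  "type2 \<Lambda> \<longleftrightarrow> (\<exists>f :: real \<Rightarrow> real. f \<in> borel_measurable lebesgue \<and> (\<forall>x. 0 \<le> f x) \<and>
     emeasure lebesgue (div_set f \<Lambda>) > 0 \<and> emeasure lebesgue (conv_set f \<Lambda>) > 0)"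

end

theory Submission
  imports Defs "HOL-Probability.Infinite_Product_Measure"
begin

text \<open>The function \<open>f\<close> is rounded to \<open>{0, 1}\<close> at random. Cut the line into countably many cells so small
  that, for \<open>\<bar>x\<bar> \<le> K\<close>, distinct \<open>\<lambda> \<in> \<Lambda>\<close> put \<open>x + \<lambda>\<close> into distinct cells; discreteness of \<open>\<Lambda>\<close> allows
  this. Attach independent uniform variables \<open>u\<close> on \<open>[0, 1]\<close> to the cells and let \<open>E\<close> consist of all \<open>y\<close>
  for which \<open>f y\<close> exceeds the variable of the cell of \<open>y\<close>. For fixed \<open>x\<close> the events \<open>x + \<lambda> \<in> E\<close> are
  independent with probabilities \<open>min 1 (f (x + \<lambda>))\<close>, so by the two Borel--Cantelli lemmas almost
  surely finitely many of them occur iff the series converges at \<open>x\<close>. By Fubini some choice of \<open>u\<close>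
  works for almost every \<open>x \<in> [-K, K]\<close>. Finally \<open>E\<close> is enlarged to an open set, with an excess so
  small that, by Borel--Cantelli once more, almost every \<open>x \<in> [-K, K]\<close> has only finitely many
  translates in it.\<close>

section \<open>Borel--Cantelli for independent uniform variables\<close>

lemma emeasure_uniform_lessThan:
  fixes a :: real
  assumes "0 \<le> a"
  shows "emeasure (uniform_measure lborel {0..1}) {..<a} = ennreal (min 1 a)"
proof -
  have "emeasure lborel ({0..1} \<inter> {..<a}) = ennreal (min 1 a)"
  proof (cases "a \<le> 1")
    case True
    then have "{0..1} \<inter> {..<a} = {0..<a}" by auto
    then show ?thesis using assms True by simp
  next
    case False
    then have "{0..1} \<inter> {..<a} = {0..1}" by auto
    then show ?thesis using False by simp
  qed
  then show ?thesis by (simp add: divide_ennreal_def)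
qed

lemma borel_measurable_PiM_uniform_component:
  "(\<lambda>u. u i) \<in> borel_measurable (PiM UNIV (\<lambda>_. uniform_measure lborel {0..1::real}))"
proof -
  have "(\<lambda>u. u i) \<in> PiM UNIV (\<lambda>_. uniform_measure lborel {0..1::real}) \<rightarrow>\<^sub>M
      uniform_measure lborel {0..1}"
    by (rule measurable_component_singleton) simp
  also have "\<dots> = borel_measurable (PiM UNIV (\<lambda>_. uniform_measure lborel {0..1::real}))"
    by (rule measurable_cong_sets) simp_all
  finally show ?thesis .
qed

text \<open>If the truncated series converges, its terms are eventually below 1, where the
  truncation changes nothing.\<close>

lemma summable_min_one_iff:
  fixes a :: "nat \<Rightarrow> real"
  assumes "\<And>n. 0 \<le> a n"
  shows "summable (\<lambda>n. min 1 (a n)) \<longleftrightarrow> summable a"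
proof
  assume "summable a"
  then show "summable (\<lambda>n. min 1 (a n))"
    by (rule summable_comparison_test'[where N = 0]) (use assms in auto)
next
  assume s: "summable (\<lambda>n. min 1 (a n))"
  then have "(\<lambda>n. min 1 (a n)) \<longlonglongrightarrow> 0" by (rule summable_LIMSEQ_zero)
  then have "\<forall>\<^sub>F n in sequentially. min 1 (a n) < 1" by (rule order_tendstoD) simp
  then have "\<forall>\<^sub>F n in sequentially. min 1 (a n) = a n" by eventually_elim auto
  then show "summable a" using s by (simp add: summable_cong)
qed

text \<open>Injectivity of \<open>J\<close> makes the events \<open>u (J n) < a n\<close>
  independent, with probabilities \<open>min 1 (a n)\<close>. If \<open>a\<close> is summable, the
  first Borel--Cantelli lemma applies. Otherwise the second is proved directly: the probability that
  no event with index at least \<open>m\<close> occurs is bounded by \<open>exp (- s)\<close> for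
  every partial sum \<open>s\<close> from \<open>m\<close> on, and these sums are unbounded.\<close>

lemma AE_finite_uniform_less_iff_summable:
  fixes a :: "nat \<Rightarrow> real" and J :: "nat \<Rightarrow> 'i"
  defines "P \<equiv> PiM UNIV (\<lambda>_::'i. uniform_measure lborel {0..1::real})"
  assumes "inj J" and nonneg: "\<And>n. 0 \<le> a n"
  shows "AE u in P. finite {n. u (J n) < a n} \<longleftrightarrow> summable a"
proof -
  let ?U = "uniform_measure lborel {0..1::real}"
  have U: "prob_space ?U" by (rule prob_space_uniform_measure) auto
  interpret U: prob_space ?U by (fact U)
  interpret P: product_prob_space "\<lambda>_::'i. ?U" UNIV by unfold_locales
  interpret PP: prob_space P unfolding P_def by (rule P.P.prob_space_axioms)
  have [simp]: "space P = UNIV" by (simp add: P_def space_PiM PiE_UNIV_domain)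
  have coord[measurable]: "(\<lambda>u. u i) \<in> borel_measurable P" for i
    unfolding P_def by (rule borel_measurable_PiM_uniform_component)
  have prob: "U.prob {..<x} = min 1 x" if "0 \<le> x" for x :: real
    using emeasure_uniform_lessThan[OF that] that by (simp add: measure_def)
  have prob': "U.prob {x..} = 1 - min 1 x" if "0 \<le> x" for x :: real
  proof -
    have "U.prob (space ?U - {..<x}) = 1 - U.prob {..<x}" by (rule U.prob_compl) simp
    moreover have "space ?U - {..<x} = {x..}" by auto
    ultimately show ?thesis using prob[OF that] by simp
  qed
  show ?thesis
  proof (cases "summable a")
    case True
    have m: "emeasure P {u. u (J n) < a n} = ennreal (min 1 (a n))" for n
      using P.emeasure_PiM_Collect_single[of "J n" "{..<a n}"] emeasure_uniform_lessThan[OF nonneg]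
      by (simp add: P_def[symmetric])
    have "AE u in P. eventually (\<lambda>n. u \<in> space P - {u. u (J n) < a n}) sequentially"
    proof (rule borel_cantelli_AE1)
      show "{u. u (J n) < a n} \<in> sets P" for n
      proof -
        have "{u \<in> space P. u (J n) < a n} \<in> sets P" by measurable
        then show ?thesis by simp
      qed
      show "emeasure P {u. u (J n) < a n} < \<infinity>" for n by (simp add: m)
      show "summable (\<lambda>n. measure P {u. u (J n) < a n})"
        using True by (simp add: measure_def m nonneg summable_min_one_iff)
    qed
    then show ?thesis
    proof eventually_elim
      case (elim u)
      then have "finite {n. \<not> u \<in> space P - {u. u (J n) < a n}}"
        by (simp add: eventually_cofinite cofinite_eq_sequentially[symmetric])
      then show ?case using True by simp
    qed
  next
    case False
    have "AE u in P. \<not> (\<forall>n\<ge>m. a n \<le> u (J n))" for m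
    proof -
      have meas[measurable]: "{u. \<forall>n\<in>A. a n \<le> u (J n)} \<in> sets P" for A
      proof -
        have "{u \<in> space P. \<forall>n. n \<in> A \<longrightarrow> a n \<le> u (J n)} \<in> sets P" by measurable
        then show ?thesis by (simp add: Ball_def)
      qed
      let ?S = "\<lambda>k. \<Sum>n=m..<k. min 1 (a n)"
      have bound: "PP.prob {u. \<forall>n\<in>{m..}. a n \<le> u (J n)} \<le> exp (- ?S k)" for k
      proof -
        have "PP.prob {u. \<forall>n\<in>{m..}. a n \<le> u (J n)} \<le> PP.prob {u. \<forall>n\<in>{m..<k}. a n \<le> u (J n)}"
          by (rule PP.finite_measure_mono) auto
        \<comment> \<open>The condition is reindexed by the coordinates \<open>i = J n\<close>, with
          \<open>inv J\<close> recovering \<open>n\<close>, to match the product formula for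
          cylinder sets.\<close>
        also have "{u. \<forall>n\<in>{m..<k}. a n \<le> u (J n)} =
            {u\<in>space P. \<forall>i\<in>J ` {m..<k}. u i \<in> {a (inv J i)..}}"
          using \<open>inj J\<close> by auto
        also have "PP.prob \<dots> = (\<Prod>i\<in>J ` {m..<k}. U.prob {a (inv J i)..})"
        proof -
          have "emeasure P {u\<in>space P. \<forall>i\<in>J ` {m..<k}. u i \<in> {a (inv J i)..}} =
             (\<Prod>i\<in>J ` {m..<k}. emeasure ?U {a (inv J i)..})"
            unfolding P_def by (rule P.emeasure_PiM_Collect) auto
          then show ?thesis
            by (simp add: U.emeasure_eq_measure PP.emeasure_eq_measure prod_ennreal prod_nonneg)
        qed
        also have "\<dots> = (\<Prod>n=m..<k. 1 - min 1 (a n))"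
          using \<open>inj J\<close> by (subst prod.reindex) (auto intro: inj_on_subset simp: prob' nonneg intro!: prod.cong)
        \<comment> \<open>This is \<open>1 + t \<le> exp t\<close> at
          \<open>t = - min 1 (a n)\<close>.\<close>
        also have "\<dots> \<le> (\<Prod>n=m..<k. exp (- min 1 (a n)))"
          by (intro prod_mono conjI) (auto, metis exp_ge_add_one_self uminus_add_conv_diff add.commute)
        also have "\<dots> = exp (- ?S k)" by (simp add: exp_sum sum_negf[symmetric])
        finally show ?thesis .
      qed
      \<comment> \<open>Bounded sums from \<open>m\<close> on would make the shifted series
        summable, and with it \<open>a\<close> itself.\<close>
      have unb: "\<exists>k. ?S k > B" for B
      proof (rule ccontr)
        assume "\<not> ?thesis"
        then have *: "?S k \<le> B" for k by (simp add: not_less)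
        have "summable (\<lambda>n. min 1 (a (n + m)))"
        proof (rule bounded_imp_summable)
          show "0 \<le> min 1 (a (n + m))" for n using nonneg by simp
          show "(\<Sum>k\<le>n. min 1 (a (k + m))) \<le> B" for n
            using *[of "Suc n + m"] sum.shift_bounds_nat_ivl[of "\<lambda>n. min 1 (a n)" 0 m "Suc n"]
            by (simp add: atLeast0LessThan lessThan_Suc_atMost)
        qed
        then have "summable (\<lambda>n. min 1 (a n))" by (rule summable_iff_shift[THEN iffD1])
        with False nonneg show False by (simp add: summable_min_one_iff)
      qed
      have "PP.prob {u. \<forall>n\<in>{m..}. a n \<le> u (J n)} \<le> e" if "e > 0" for e
      proof -
        obtain k where "?S k > - ln e" using unb by blast
        then have "exp (- ?S k) \<le> exp (ln e)" by simp
        with bound[of k] that show ?thesis by simp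
      qed
      then have "PP.prob {u. \<forall>n\<in>{m..}. a n \<le> u (J n)} \<le> 0"
        by (rule field_le_epsilon[of _ 0, unfolded add_0])
      then have "PP.prob {u. \<forall>n\<in>{m..}. a n \<le> u (J n)} = 0"
        by (simp add: measure_le_0_iff)
      then have "{u. \<forall>n\<in>{m..}. a n \<le> u (J n)} \<in> null_sets P"
        by (simp add: null_sets_def PP.emeasure_eq_measure)
      then show ?thesis by (rule AE_I') auto
    qed
    then have "AE u in P. \<forall>m. \<not> (\<forall>n\<ge>m. a n \<le> u (J n))" by (simp add: AE_all_countable)
    then show ?thesis
    proof eventually_elim
      case (elim u)
      then have "infinite {n. u (J n) < a n}"
        unfolding infinite_nat_iff_unbounded_le by (simp add: not_le)
      then show ?case using False by simp
    qed
  qed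
qed

section \<open>Convergence sets in terms of series and counting\<close>

lemma suminf_ennreal_neq_top_iff_summable:
  fixes a :: "nat \<Rightarrow> real"
  assumes "\<And>n. 0 \<le> a n"
  shows "(\<Sum>n. ennreal (a n)) \<noteq> top \<longleftrightarrow> summable a"
  using summable_suminf_not_top[OF assms] ennreal_suminf_neq_top[OF _ assms] by (rule iffI)

lemma translate_sum_eq_suminf:
  assumes "bij_betw l (UNIV :: nat set) \<Lambda>"
  shows "translate_sum f \<Lambda> x = (\<Sum>n. ennreal (f (x + l n)))"
proof -
  have "translate_sum f \<Lambda> x = (\<Sum>\<^sub>\<infinity>n. ennreal (f (x + l n)))"
    unfolding translate_sum_def by (rule infsum_reindex_bij_betw[OF assms, symmetric])
  also have "\<dots> = (\<Sum>n. ennreal (f (x + l n)))"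
    by (rule sums_unique, rule has_sum_imp_sums, rule has_sum_infsum)
      (rule nonneg_summable_on_complete, simp)
  finally show ?thesis .
qed

lemma conv_set_iff_summable:
  assumes "bij_betw l (UNIV :: nat set) \<Lambda>" and "\<And>x. 0 \<le> f x"
  shows "x \<in> conv_set f \<Lambda> \<longleftrightarrow> summable (\<lambda>n. f (x + l n))"
proof -
  have "x \<in> conv_set f \<Lambda> \<longleftrightarrow> (\<Sum>n. ennreal (f (x + l n))) \<noteq> top"
    unfolding conv_set_def translate_sum_eq_suminf[OF assms(1)]
    by (simp only: mem_Collect_eq infinity_ennreal_def less_top)
  also have "\<dots> \<longleftrightarrow> summable (\<lambda>n. f (x + l n))"
    by (rule suminf_ennreal_neq_top_iff_summable) (rule assms(2))
  finally show ?thesis .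
qed

lemma conv_set_sets_borel:
  assumes "bij_betw l (UNIV :: nat set) \<Lambda>" and [measurable]: "f \<in> borel_measurable borel"
  shows "conv_set f \<Lambda> \<in> sets borel"
  unfolding conv_set_def translate_sum_eq_suminf[OF assms(1)] by measurable

text \<open>For an indicator the sum counts the \<open>l\<close> that carry \<open>x\<close> into
  \<open>A\<close>, and infinitely many ones add up to infinity.\<close>

lemma conv_set_indicator_iff:
  fixes \<Lambda> :: "real set"
  shows "x \<in> conv_set (indicator A) \<Lambda> \<longleftrightarrow> finite {l \<in> \<Lambda>. x + l \<in> A}"
proof -
  have "translate_sum (indicator A) \<Lambda> x = (\<Sum>\<^sub>\<infinity>l\<in>{l \<in> \<Lambda>. x + l \<in> A}. 1)"
    unfolding translate_sum_def by (rule infsum_cong_neutral) auto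
  also have "\<dots> < \<infinity> \<longleftrightarrow> finite {l \<in> \<Lambda>. x + l \<in> A}"
  proof (cases "finite {l \<in> \<Lambda>. x + l \<in> A}")
    case True
    then show ?thesis by (simp add: of_nat_less_top)
  next
    case False
    then have "(\<Sum>\<^sub>\<infinity>l\<in>{l \<in> \<Lambda>. x + l \<in> A}. 1 :: ennreal) = \<infinity>"
      by (rule infsum_superconst_infinite_ennreal[where b = 1, rotated -1]) simp_all
    then show ?thesis using False by simp
  qed
  finally show ?thesis by (simp add: conv_set_def)
qed

lemma div_set_eq_Compl: "div_set f \<Lambda> = - conv_set f \<Lambda>"
  by (auto simp: div_set_def conv_set_def less_top[symmetric])

section \<open>Null sets and translation\<close>

text \<open>The exceptional set is covered by a null set of \<open>lborel\<close>, and
  \<open>lborel\<close> is translation invariant.\<close>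

lemma AE_lebesgue_translate:
  fixes P :: "real \<Rightarrow> bool"
  assumes "AE x in lebesgue. P x"
  shows "AE x in lebesgue. P (x + a)"
proof -
  from assms obtain N where N: "{x. \<not> P x} \<subseteq> N" "N \<in> null_sets lborel"
    unfolding AE_completion_iff by (auto simp: eventually_ae_filter)
  have "{x. x - (- a) \<in> N} \<in> null_sets lborel" by (rule null_sets_translation) fact
  moreover have "{x. \<not> P (x + a)} \<subseteq> {x. x - (- a) \<in> N}" using N(1) by auto
  ultimately show ?thesis unfolding AE_completion_iff by (auto simp: eventually_ae_filter)
qed

lemma countable_discrete_reals:
  assumes "discrete_reals \<Lambda>"
  shows "countable \<Lambda>"
proof -
  have sub: "\<Lambda> \<subseteq> (\<Union>n::nat. \<Lambda> \<inter> {- real n..real n})"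
  proof
    fix x assume "x \<in> \<Lambda>"
    moreover obtain n :: nat where "\<bar>x\<bar> \<le> real n" using real_arch_simple by blast
    ultimately show "x \<in> (\<Union>n::nat. \<Lambda> \<inter> {- real n..real n})"
      by (intro UN_I[of n]) (auto simp: abs_le_iff)
  qed
  have "finite (\<Lambda> \<inter> {- real n..real n})" for n :: nat
    using assms by (simp add: discrete_reals_def)
  then have "countable (\<Union>n::nat. \<Lambda> \<inter> {- real n..real n})"
    by (intro countable_UN[OF countableI_type] countable_finite)
  with sub show ?thesis by (rule countable_subset)
qed

text \<open>Countably many translates of a null set have a null union. This permits replacing a
  Lebesgue measurable function by a Borel one.\<close>

lemma AE_conv_set_cong:
  assumes "countable \<Lambda>" and "AE x in lebesgue. f x = g x"
  shows "AE x in lebesgue. x \<in> conv_set f \<Lambda> \<longleftrightarrow> x \<in> conv_set g \<Lambda>"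
proof -
  have "AE x in lebesgue. \<forall>l\<in>\<Lambda>. f (x + l) = g (x + l)"
    unfolding AE_ball_countable[OF assms(1)]
    using AE_lebesgue_translate[OF assms(2)] by blast
  then show ?thesis
  proof eventually_elim
    case (elim x)
    then have "translate_sum f \<Lambda> x = translate_sum g \<Lambda> x"
      unfolding translate_sum_def by (intro infsum_cong) simp
    then show ?case by (simp add: conv_set_def)
  qed
qed

section \<open>Enlargement to an open set\<close>

text \<open>For \<open>\<bar>x\<bar> \<le> K\<close> only the finitely many \<open>l\<close> in
  \<open>S m\<close> can carry \<open>x\<close> into the ball of radius \<open>m\<close>. If the
  excess over \<open>E\<close> inside that ball has measure at most \<open>\<delta> m\<close>, the
  points carried into it by some \<open>l\<close> in \<open>S m\<close> have measure at most
  \<open>card (S m) * \<delta> m\<close>. Making this summable in \<open>m\<close> allows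
  Borel--Cantelli.\<close>

lemma open_superset_finite_translates:
  fixes E :: "real set" and K :: real
  assumes "discrete_reals \<Lambda>" and E: "E \<in> sets lebesgue"
  obtains G where "open G" "E \<subseteq> G"
    "AE x in lebesgue. \<bar>x\<bar> \<le> K \<longrightarrow> finite {l \<in> \<Lambda>. x + l \<in> G - E}"
proof -
  define S where "S m = \<Lambda> \<inter> {- real m - K..real m + K}" for m :: nat
  have finS: "finite (S m)" for m
    using assms(1) by (simp add: S_def discrete_reals_def)
  \<comment> \<open>The summand 1 in the denominator keeps \<open>\<delta> m\<close> well defined
    and positive when \<open>S m\<close> is empty.\<close>
  define \<delta> where "\<delta> m = (1/2)^m / (1 + real (card (S m)))" for m :: nat
  have \<delta>: "\<delta> m > 0" "real (card (S m)) * \<delta> m \<le> (1/2)^m" for m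
    by (auto simp: \<delta>_def divide_simps add_pos_nonneg)
  have "\<exists>T. open T \<and> E \<inter> ball 0 (real m) \<subseteq> T \<and> T - (E \<inter> ball 0 (real m)) \<in> lmeasurable \<and>
      emeasure lebesgue (T - (E \<inter> ball 0 (real m))) < ennreal (\<delta> m)" for m :: nat
  proof -
    have "E \<inter> ball 0 (real m) \<in> sets lebesgue" using E by auto
    from sets_lebesgue_outer_open[OF this \<delta>(1)] show ?thesis by metis
  qed
  then obtain T where T: "\<And>m::nat. open (T m)" "\<And>m. E \<inter> ball 0 (real m) \<subseteq> T m"
    "\<And>m. emeasure lebesgue (T m - (E \<inter> ball 0 (real m))) < ennreal (\<delta> m)"
    by metis
  \<comment> \<open>Cutting with the ball before removing \<open>E\<close> keeps \<open>B m\<close>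
    inside the small excess of \<open>T m\<close>, although only a bounded part of \<open>E\<close>
    was approximated.\<close>
  define B where "B m = T m \<inter> ball 0 (real m) - E" for m :: nat
  have B_sets: "B m \<in> sets lebesgue" for m
    using T(1)[of m] E by (auto simp: B_def)
  have "B m \<in> lmeasurable \<and> measure lebesgue (B m) \<le> \<delta> m" for m
  proof -
    have "emeasure lebesgue (B m) \<le> emeasure lebesgue (T m - (E \<inter> ball 0 (real m)))"
      using T(1)[of m] E by (intro emeasure_mono sets.Diff sets.Int) (auto simp: B_def)
    also note T(3)[of m]
    finally have *: "emeasure lebesgue (B m) < ennreal (\<delta> m)" .
    then have "emeasure lebesgue (B m) < \<infinity>" by (rule less_trans) simp
    with * B_sets \<delta>(1)[of m] show ?thesis
      by (auto simp: fmeasurable_def measure_def intro!: enn2real_leI)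
  qed
  then have B: "B m \<in> lmeasurable" "measure lebesgue (B m) \<le> \<delta> m" for m by auto
  \<comment> \<open>\<open>A m\<close> consists of the points that some \<open>l\<close> in
    \<open>S m\<close> carries into \<open>B m\<close>.\<close>
  define A where "A m = (\<Union>l\<in>S m. (\<lambda>x. x - l) ` B m)" for m
  have A_meas: "A m \<in> lmeasurable" for m
    unfolding A_def using B(1) by (intro fmeasurable.finite_UN finS measurable_translation_subtract)
  have A_le: "measure lebesgue (A m) \<le> (1/2)^m" for m
  proof -
    have "measure lebesgue (A m) \<le> (\<Sum>l\<in>S m. measure lebesgue ((\<lambda>x. x - l) ` B m))"
      unfolding A_def using B(1)
      by (intro measure_UNION_le finS fmeasurableD measurable_translation_subtract)
    also have "\<dots> \<le> (\<Sum>l\<in>S m. \<delta> m)"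
      using B(2) by (intro sum_mono) (simp add: measure_translation_subtract)
    also have "\<dots> \<le> (1/2)^m" using \<delta>(2) by simp
    finally show ?thesis .
  qed
  \<comment> \<open>\<open>G - E\<close> is the union of the \<open>B m\<close>; the balls ensure
    that reaching \<open>B m\<close> from \<open>\<bar>x\<bar> \<le> K\<close> forces
    \<open>l\<close> into \<open>S m\<close>.\<close>
  define G where "G = (\<Union>m. T m \<inter> ball 0 (real m))"
  have "AE x in lebesgue. eventually (\<lambda>m. x \<in> space lebesgue - A m) sequentially"
  proof (rule borel_cantelli_AE1)
    show "A m \<in> sets lebesgue" for m using A_meas by blast
    show "emeasure lebesgue (A m) < \<infinity>" for m
      using A_meas[of m] unfolding fmeasurable_def by blast
    show "summable (\<lambda>m. measure lebesgue (A m))"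
      by (rule summable_comparison_test'[where N = 0 and g = "\<lambda>m. (1/2)^m"])
        (use A_le in \<open>auto intro: summable_geometric\<close>)
  qed
  then have "AE x in lebesgue. \<bar>x\<bar> \<le> K \<longrightarrow> finite {l \<in> \<Lambda>. x + l \<in> G - E}"
  proof (rule eventually_mono, intro impI)
    fix x
    assume "\<forall>\<^sub>F m in sequentially. x \<in> space lebesgue - A m" and "\<bar>x\<bar> \<le> K"
    then obtain M where M: "\<And>m. m \<ge> M \<Longrightarrow> x \<notin> A m"
      by (auto simp: eventually_sequentially)
    have "{l \<in> \<Lambda>. x + l \<in> G - E} \<subseteq> (\<Union>m<M. S m)"
    proof
      fix l assume "l \<in> {l \<in> \<Lambda>. x + l \<in> G - E}"
      then obtain m where l: "l \<in> \<Lambda>" "x + l \<in> B m" "\<bar>x + l\<bar> < real m"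
        by (auto simp: G_def B_def dist_real_def)
      then have "l \<in> S m" using \<open>\<bar>x\<bar> \<le> K\<close> by (auto simp: S_def)
      moreover from this have "x \<in> A m" using l(2) by (force simp: A_def)
      then have "m < M" using M by (meson not_le)
      ultimately show "l \<in> (\<Union>m<M. S m)" by blast
    qed
    then show "finite {l \<in> \<Lambda>. x + l \<in> G - E}"
      by (rule finite_subset) (simp add: finS)
  qed
  moreover have "open G" using T(1) by (auto simp: G_def)
  moreover have "E \<subseteq> G"
  proof
    fix y assume "y \<in> E"
    moreover obtain m :: nat where "\<bar>y\<bar> < real m" using reals_Archimedean2 by blast
    ultimately show "y \<in> G" using T(2)[of m] by (auto simp: G_def dist_real_def)
  qed
  ultimately show thesis using that by blast
qed

text \<open>Countably many bounded windows exhaust the line, so they cannot all meet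
  \<open>A\<close> in a null set. All larger \<open>k'\<close> are included so that two sets can
  share one window.\<close>

lemma ex_lebesgue_positive_bounded_part:
  fixes A :: "real set"
  assumes "emeasure lebesgue A > 0"
  obtains k :: nat where "\<And>k'. k' \<ge> k \<Longrightarrow> \<not> (AE x in lebesgue. \<bar>x\<bar> \<le> real k' \<longrightarrow> x \<notin> A)"
proof -
  have "\<not> (AE x in lebesgue. x \<notin> A)"
  proof
    assume "AE x in lebesgue. x \<notin> A"
    then obtain N where "A \<subseteq> N" "N \<in> null_sets lebesgue"
      by (auto simp: eventually_ae_filter)
    then have "emeasure lebesgue A \<le> 0"
      using emeasure_mono[of A N lebesgue] by (simp only: null_setsD1 null_setsD2)
    with assms show False by simp
  qed
  moreover have "AE x in lebesgue. x \<notin> A" if "\<And>k::nat. AE x in lebesgue. \<bar>x\<bar> \<le> real k \<longrightarrow> x \<notin> A"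
  proof -
    have "AE x in lebesgue. \<forall>k::nat. \<bar>x\<bar> \<le> real k \<longrightarrow> x \<notin> A"
      unfolding AE_all_countable using that by blast
    then show ?thesis by eventually_elim (use real_arch_simple in blast)
  qed
  ultimately obtain k :: nat where k: "\<not> (AE x in lebesgue. \<bar>x\<bar> \<le> real k \<longrightarrow> x \<notin> A)" by blast
  show thesis
  proof (rule that[of k])
    fix k' assume "k \<le> k'"
    show "\<not> (AE x in lebesgue. \<bar>x\<bar> \<le> real k' \<longrightarrow> x \<notin> A)"
    proof
      assume "AE x in lebesgue. \<bar>x\<bar> \<le> real k' \<longrightarrow> x \<notin> A"
      then have "AE x in lebesgue. \<bar>x\<bar> \<le> real k \<longrightarrow> x \<notin> A"
        by eventually_elim (use \<open>k \<le> k'\<close> in auto)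
      with k show False ..
    qed
  qed
qed

section \<open>Random rounding on cells\<close>

text \<open>\<open>I\<close> records the unit interval of \<open>y\<close> and the cell of length
  \<open>1 / q i\<close> within it. When \<open>\<bar>x\<bar> \<le> K\<close>, the \<open>l\<close>
  with \<open>x + l\<close> in the interval starting at \<open>i\<close> lie in the finite set
  \<open>S i\<close>, so their gaps are bounded below; scaling by \<open>q i\<close> puts distinct
  points at least 1 apart, and their floors differ. If \<open>S i\<close> has at most one point,
  then \<open>q i = 0\<close> and the interval is a single cell.\<close>

lemma ex_separating_cells:
  fixes K :: real
  assumes "discrete_reals \<Lambda>"
  obtains I :: "real \<Rightarrow> int \<times> int" where "I \<in> borel \<rightarrow>\<^sub>M count_space UNIV"
    "\<And>x l l'. \<bar>x\<bar> \<le> K \<Longrightarrow> l \<in> \<Lambda> \<Longrightarrow> l' \<in> \<Lambda> \<Longrightarrow> I (x + l) = I (x + l') \<Longrightarrow> l = l'"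
proof -
  define S where "S i = \<Lambda> \<inter> {of_int i - K..of_int i + 1 + K}" for i :: int
  have finS: "finite (S i)" for i
    using assms(1) by (simp add: S_def discrete_reals_def)
  define q where "q i = (\<Sum>(a, b)\<in>S i \<times> S i. 1 / \<bar>a - b\<bar>)" for i
  \<comment> \<open>\<open>1 / q i\<close> is at most the minimal gap of \<open>S i\<close>; the diagonal terms are \<open>1 / 0 = 0\<close>.\<close>
  define I where "I y = (\<lfloor>y\<rfloor>, \<lfloor>y * q \<lfloor>y\<rfloor>\<rfloor>)" for y
  have [measurable]: "(\<lambda>y::real. q \<lfloor>y\<rfloor>) \<in> borel_measurable borel"
    by (rule measurable_compose[OF measurable_real_floor, where g = q]) simp
  have "I \<in> borel \<rightarrow>\<^sub>M count_space UNIV \<Otimes>\<^sub>M count_space UNIV"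
    unfolding I_def by measurable
  then have "I \<in> borel \<rightarrow>\<^sub>M count_space UNIV"
    by (simp add: pair_measure_countable)
  moreover have "l = l'"
    if "\<bar>x\<bar> \<le> K" "l \<in> \<Lambda>" "l' \<in> \<Lambda>" and eq: "I (x + l) = I (x + l')" for x l l'
  proof (rule ccontr)
    assume "l \<noteq> l'"
    define i where "i = \<lfloor>x + l\<rfloor>"
    have i: "\<lfloor>x + l'\<rfloor> = i" "\<lfloor>(x + l) * q i\<rfloor> = \<lfloor>(x + l') * q i\<rfloor>"
      using eq by (auto simp: I_def i_def)
    have "of_int i \<le> x + l" "x + l \<le> of_int i + 1" "of_int i \<le> x + l'" "x + l' \<le> of_int i + 1"
      using i(1) i_def by linarith+
    then have "(l, l') \<in> S i \<times> S i" using that by (auto simp: S_def)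
    then have "(\<lambda>(a, b). 1 / \<bar>a - b\<bar>) (l, l') \<le> q i"
      unfolding q_def by (intro member_le_sum finite_cartesian_product finS) auto
    then have "1 \<le> \<bar>l - l'\<bar> * q i" using \<open>l \<noteq> l'\<close> by (simp add: field_simps)
    moreover have "0 \<le> q i" by (auto simp: q_def intro!: sum_nonneg)
    ultimately have "1 \<le> \<bar>(x + l) * q i - (x + l') * q i\<bar>"
      by (simp add: abs_mult left_diff_distrib[symmetric])
    with i(2) show False by linarith
  qed
  ultimately show thesis using that by blast
qed

text \<open>For each fixed \<open>x\<close> in the window, almost every \<open>u\<close> gives the
  right answer at \<open>x\<close>. Fubini exchanges the quantifiers, so one \<open>u\<close> is
  right for almost every \<open>x\<close>.\<close>

lemma ex_borel_set_conv_set_eq: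
  fixes f :: "real \<Rightarrow> real" and K :: real
  assumes "discrete_reals \<Lambda>" "infinite \<Lambda>"
    and f[measurable]: "f \<in> borel_measurable borel" and nonneg: "\<And>x. 0 \<le> f x"
  obtains E where "E \<in> sets borel"
    "AE x in lborel. \<bar>x\<bar> \<le> K \<longrightarrow> (x \<in> conv_set (indicator E) \<Lambda> \<longleftrightarrow> x \<in> conv_set f \<Lambda>)"
proof -
  obtain I :: "real \<Rightarrow> int \<times> int" where I[measurable]: "I \<in> borel \<rightarrow>\<^sub>M count_space UNIV"
    and sep: "\<And>x l l'. \<bar>x\<bar> \<le> K \<Longrightarrow> l \<in> \<Lambda> \<Longrightarrow> l' \<in> \<Lambda> \<Longrightarrow> I (x + l) = I (x + l') \<Longrightarrow> l = l'"
    using ex_separating_cells[OF assms(1)] by blast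
  have E_borel: "{y. u (I y) < f y} \<in> sets borel" for u :: "int \<times> int \<Rightarrow> real"
  proof -
    have "(\<lambda>y. u (I y)) \<in> borel_measurable borel"
      by (rule measurable_compose[OF I, where g = u]) simp
    from borel_measurable_less[OF this f] show ?thesis by simp
  qed
  define l where "l = from_nat_into \<Lambda>"
  have l: "bij_betw l UNIV \<Lambda>"
    unfolding l_def using assms(1,2) by (intro bij_betw_from_nat_into countable_discrete_reals)
  then have l_in: "l n \<in> \<Lambda>" and l_inj: "inj l" for n by (auto simp: bij_betw_def)
  let ?U = "uniform_measure lborel {0..1::real}"
  define P where "P = PiM UNIV (\<lambda>_::int \<times> int. ?U)"
  interpret P: prob_space P
    unfolding P_def by (intro prob_space_PiM prob_space_uniform_measure) auto
  interpret pair_sigma_finite lborel P ..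
  have coord[measurable]: "(\<lambda>u. u i) \<in> borel_measurable P" for i
    unfolding P_def by (rule borel_measurable_PiM_uniform_component)
  \<comment> \<open>Joint measurability holds because the selected coordinate ranges over a
    countable set of cells.\<close>
  have eval[measurable]: "(\<lambda>(x, u). u (I (x + l n))) \<in> borel_measurable (lborel \<Otimes>\<^sub>M P)" for n
    unfolding case_prod_beta
    by (rule measurable_compose_countable[where f = "\<lambda>i z. snd z i" and g = "\<lambda>z. I (fst z + l n)"])
      measurable
  define Q where "Q x u \<longleftrightarrow> (finite {n. u (I (x + l n)) < f (x + l n)} \<longleftrightarrow> summable (\<lambda>n. f (x + l n)))" for x u
  \<comment> \<open>Finiteness and summability are restated through countable quantifiers and an
    \<open>ennreal\<close> series, from which the measurability of \<open>Q\<close> on the product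
    can be derived.\<close>
  have Q_iff: "Q x u \<longleftrightarrow> ((\<exists>m. \<forall>n. u (I (x + l n)) < f (x + l n) \<longrightarrow> n < m) \<longleftrightarrow>
      (\<Sum>n. ennreal (f (x + l n))) \<noteq> top)" for x u
  proof -
    have "summable (\<lambda>n. f (x + l n)) \<longleftrightarrow> (\<Sum>n. ennreal (f (x + l n))) \<noteq> top"
      by (simp add: suminf_ennreal_neq_top_iff_summable nonneg)
    then show ?thesis unfolding Q_def finite_nat_iff_bounded by auto
  qed
  have "AE x in lborel. AE u in P. \<bar>x\<bar> \<le> K \<longrightarrow> Q x u"
  proof (rule AE_I2)
    fix x
    show "AE u in P. \<bar>x\<bar> \<le> K \<longrightarrow> Q x u"
    proof (cases "\<bar>x\<bar> \<le> K")
      case True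
      \<comment> \<open>Distinct cells carry independent variables; this is where the separation is
        used.\<close>
      have "inj (\<lambda>n. I (x + l n))"
        using sep[OF True l_in l_in] l_inj by (auto simp: inj_on_def)
      then have "AE u in P. Q x u"
        unfolding Q_def P_def by (rule AE_finite_uniform_less_iff_summable) (rule nonneg)
      then show ?thesis by eventually_elim simp
    qed simp
  qed
  moreover have "(AE x in lborel. AE u in P. \<bar>x\<bar> \<le> K \<longrightarrow> Q x u) \<longleftrightarrow>
      (AE u in P. AE x in lborel. \<bar>x\<bar> \<le> K \<longrightarrow> Q x u)"
  proof (rule AE_commute)
    have eval': "(\<lambda>z. snd z (I (fst z + l n))) \<in> borel_measurable (lborel \<Otimes>\<^sub>M P)" for n
      using eval by (simp add: case_prod_beta)
    note eval'[measurable]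
    show "{z \<in> space (lborel \<Otimes>\<^sub>M P). \<bar>fst z\<bar> \<le> K \<longrightarrow> Q (fst z) (snd z)} \<in> sets (lborel \<Otimes>\<^sub>M P)"
      unfolding Q_iff by measurable
  qed
  ultimately have "AE u in P. AE x in lborel. \<bar>x\<bar> \<le> K \<longrightarrow> Q x u" by blast
  \<comment> \<open>In a probability space, a property that holds almost surely holds
    somewhere.\<close>
  have "\<exists>u. AE x in lborel. \<bar>x\<bar> \<le> K \<longrightarrow> Q x u"
    by (rule eventually_happens'[OF P.ae_filter_bot]) fact
  then obtain u where u: "AE x in lborel. \<bar>x\<bar> \<le> K \<longrightarrow> Q x u" by blast
  define E where "E = {y. u (I y) < f y}"
  have "E \<in> sets borel" unfolding E_def by (rule E_borel)
  moreover have "AE x in lborel. \<bar>x\<bar> \<le> K \<longrightarrow> (x \<in> conv_set (indicator E) \<Lambda> \<longleftrightarrow> x \<in> conv_set f \<Lambda>)"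
    using u
  proof eventually_elim
    case (elim x)
    have "{k \<in> \<Lambda>. x + k \<in> E} = l ` {n. u (I (x + l n)) < f (x + l n)}"
      using l by (auto simp: E_def bij_betw_def)
    then have "finite {k \<in> \<Lambda>. x + k \<in> E} \<longleftrightarrow> finite {n. u (I (x + l n)) < f (x + l n)}"
      using l_inj by (simp add: finite_image_iff inj_on_subset)
    with elim show ?case
      by (simp add: conv_set_indicator_iff conv_set_iff_summable[OF l nonneg] Q_def)
  qed
  ultimately show thesis by (rule that)
qed

section \<open>Rounding followed by open enlargement\<close>

theorem theorem3p1:
  fixes \<Lambda> :: "real set"
  assumes "\<Lambda> \<subseteq> {0..}"
    and "\<not> bounded \<Lambda>"
    and "infinite \<Lambda>"
    and "discrete_reals \<Lambda>"
    and "type2 \<Lambda>"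
  shows "\<exists>g :: real \<Rightarrow> real. (\<exists>G. open G \<and> g = indicator G) \<and>
           emeasure lebesgue (div_set g \<Lambda>) > 0 \<and> emeasure lebesgue (conv_set g \<Lambda>) > 0"
proof -
  obtain f :: "real \<Rightarrow> real" where f: "f \<in> borel_measurable lebesgue" "\<And>x. 0 \<le> f x"
    and pos: "emeasure lebesgue (div_set f \<Lambda>) > 0" "emeasure lebesgue (conv_set f \<Lambda>) > 0"
    using \<open>type2 \<Lambda>\<close> by (auto simp: type2_def)
  obtain f0 where f0: "f0 \<in> borel_measurable borel" "AE x in lborel. f x = f0 x"
    using completion_ex_borel_measurable_real[OF f(1)] by auto
  \<comment> \<open>The Borel version \<open>f0\<close> may be negative on a null set; the maximum
    restores nonnegativity everywhere.\<close>
  define f' where "f' x = max 0 (f0 x)" for x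
  have f': "f' \<in> borel_measurable borel" "\<And>x. 0 \<le> f' x"
    using f0(1) by (auto simp: f'_def[abs_def])
  have "AE x in lebesgue. f x = f' x"
    unfolding AE_completion_iff using f0(2)
    by eventually_elim (metis f'_def f(2) max_absorb2)
  then have conv_f': "AE x in lebesgue. x \<in> conv_set f \<Lambda> \<longleftrightarrow> x \<in> conv_set f' \<Lambda>"
    by (intro AE_conv_set_cong countable_discrete_reals assms)
  obtain k1 :: nat
    where k1: "\<And>k. k \<ge> k1 \<Longrightarrow> \<not> (AE x in lebesgue. \<bar>x\<bar> \<le> real k \<longrightarrow> x \<notin> div_set f \<Lambda>)"
    using ex_lebesgue_positive_bounded_part[OF pos(1)] by blast
  obtain k2 :: nat
    where k2: "\<And>k. k \<ge> k2 \<Longrightarrow> \<not> (AE x in lebesgue. \<bar>x\<bar> \<le> real k \<longrightarrow> x \<notin> conv_set f \<Lambda>)"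
    using ex_lebesgue_positive_bounded_part[OF pos(2)] by blast
  \<comment> \<open>The window is large enough to show both the divergence and the convergence of
    \<open>f\<close> on non-null sets.\<close>
  define K where "K = real (max k1 k2)"
  obtain E where E: "E \<in> sets borel"
    "AE x in lborel. \<bar>x\<bar> \<le> K \<longrightarrow> (x \<in> conv_set (indicator E) \<Lambda> \<longleftrightarrow> x \<in> conv_set f' \<Lambda>)"
    using ex_borel_set_conv_set_eq[OF \<open>discrete_reals \<Lambda>\<close> \<open>infinite \<Lambda>\<close> f'] by blast
  obtain G where G: "open G" "E \<subseteq> G"
    "AE x in lebesgue. \<bar>x\<bar> \<le> K \<longrightarrow> finite {l \<in> \<Lambda>. x + l \<in> G - E}"
    using open_superset_finite_translates[OF \<open>discrete_reals \<Lambda>\<close>, of E K] E(1) by auto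
  define g :: "real \<Rightarrow> real" where "g = indicator G"
  have "AE x in lebesgue. \<bar>x\<bar> \<le> K \<longrightarrow> (x \<in> conv_set (indicator E) \<Lambda> \<longleftrightarrow> x \<in> conv_set f' \<Lambda>)"
    unfolding AE_completion_iff by (fact E(2))
  with G(3) conv_f'
  have conv_g: "AE x in lebesgue. \<bar>x\<bar> \<le> K \<longrightarrow> (x \<in> conv_set g \<Lambda> \<longleftrightarrow> x \<in> conv_set f \<Lambda>)"
  proof eventually_elim
    case (elim x)
    have "{l \<in> \<Lambda>. x + l \<in> G} = {l \<in> \<Lambda>. x + l \<in> E} \<union> {l \<in> \<Lambda>. x + l \<in> G - E}"
      using G(2) by blast
    \<comment> \<open>Passing from \<open>E\<close> to \<open>G\<close> adds only finitely many
      translates at such \<open>x\<close>.\<close>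
    then have "finite {l \<in> \<Lambda>. x + l \<in> G} \<longleftrightarrow> finite {l \<in> \<Lambda>. x + l \<in> E}" if "\<bar>x\<bar> \<le> K"
      using elim(1) that by simp
    with elim show ?case
      by (auto simp: g_def conv_set_indicator_iff)
  qed
  \<comment> \<open>Measurability of \<open>A\<close> is assumed because \<open>emeasure\<close> is
    also 0 on non-measurable sets, so the value 0 alone would not make \<open>A\<close>
    null.\<close>
  have positive: "emeasure lebesgue A > 0"
    if not_null: "\<not> (AE x in lebesgue. \<bar>x\<bar> \<le> K \<longrightarrow> x \<notin> B)"
      and eq: "AE x in lebesgue. \<bar>x\<bar> \<le> K \<longrightarrow> (x \<in> A \<longleftrightarrow> x \<in> B)"
      and A: "A \<in> sets lebesgue" for A B
  proof (rule ccontr)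
    assume "\<not> ?thesis"
    then have "A \<in> null_sets lebesgue" using A by (auto simp: null_sets_def)
    then have "AE x in lebesgue. x \<notin> A" by (rule AE_not_in)
    with eq have "AE x in lebesgue. \<bar>x\<bar> \<le> K \<longrightarrow> x \<notin> B" by eventually_elim blast
    with not_null show False by blast
  qed
  have meas: "conv_set g \<Lambda> \<in> sets lebesgue"
  proof -
    have "bij_betw (from_nat_into \<Lambda>) UNIV \<Lambda>"
      using assms(3,4) by (intro bij_betw_from_nat_into countable_discrete_reals)
    then have "conv_set g \<Lambda> \<in> sets borel"
      using G(1) by (intro conv_set_sets_borel) (auto simp: g_def)
    then show ?thesis by simp
  qed
  have "emeasure lebesgue (conv_set g \<Lambda>) > 0"
    using positive[OF _ conv_g meas] k2[of "max k1 k2"] by (simp add: K_def)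
  moreover have "emeasure lebesgue (div_set g \<Lambda>) > 0"
  proof (rule positive)
    show "\<not> (AE x in lebesgue. \<bar>x\<bar> \<le> K \<longrightarrow> x \<notin> div_set f \<Lambda>)"
      using k1[of "max k1 k2"] by (simp add: K_def)
    show "AE x in lebesgue. \<bar>x\<bar> \<le> K \<longrightarrow> (x \<in> div_set g \<Lambda> \<longleftrightarrow> x \<in> div_set f \<Lambda>)"
      using conv_g by eventually_elim (simp add: div_set_eq_Compl)
    show "div_set g \<Lambda> \<in> sets lebesgue" using meas by (auto simp: div_set_eq_Compl Compl_in_sets_lebesgue)
  qed
  ultimately show ?thesis using G(1) g_def by blast
qed

end
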